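(* For every computation $M$ of $\lambda_{\copyright}$, the following are equivalent: (1) $M$ is $\to_{\copyright}$-normalizing; (2) $M$ is $\to_{\sigma\beta_c}$-normalizing.
   Context: The computational core $\lambda_{\copyright}$ has values $V,W ::= x \mid \lambda x.M$ and computations $M,N,L ::= \,!V \mid VM$ ($x$ ranging over a countable set of variables, terms up to $\alpha$-renaming). Rules: $\beta_c$: $(\lambda x.M)(!V) \mapsto M\{V/x\}$; $\mathsf{id}$: $(\lambda x.!x)M \mapsto M$; $\sigma$: $(\lambda y.N)((\lambda x.M)L) \mapsto (\lambda x.(\lambda y.N)M)L$ provided $x\notin \mathrm{fv}(N)$; $\sigma\beta_c=\sigma\cup\beta_c$, $\copyright=\beta_c\cup\mathsf{id}\cup\sigma$. Contexts: $C ::= [\,] \mid\, !(\lambda x.C) \mid VC \mid (\lambda x.C)M$; $\to_\rho$ is the closure of rule $\rho$ under contexts. A term $M$ is $\to$-normalizing (weakly normalizing) if there is a $\to$-sequence from $M$ ending in a $\to$-normal form (a term with no $\to$-step). *)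

theory Defs
  imports Main
begin

text \<open>Terms up to \<open>\<alpha>\<close>-renaming are represented with de Bruijn indices; the free variables
  form the countable set of indices that point beyond the enclosing binders.\<close>

datatype val =
    Var nat
  | Lam computation
and computation =
    Ret val                (* \<open>!V\<close> *)
  | App val computation    (* \<open>V M\<close> *)

text \<open>Renaming that makes room for a new binder at index \<open>k\<close>.\<close>

primrec lift_val :: "nat \<Rightarrow> val \<Rightarrow> val"
  and lift_computation :: "nat \<Rightarrow> computation \<Rightarrow> computation" where
  "lift_val k (Var i) = Var (if i < k then i else Suc i)"
| "lift_val k (Lam M) = Lam (lift_computation (Suc k) M)"
| "lift_computation k (Ret V) = Ret (lift_val k V)"
| "lift_computation k (App V M) = App (lift_val k V) (lift_computation k M)"

text \<open>Capture-avoiding substitution of \<open>U\<close> for index \<open>k\<close>. The binder of \<open>k\<close> disappears, so the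
  indices above \<open>k\<close> are decremented.\<close>

primrec subst_val :: "nat \<Rightarrow> val \<Rightarrow> val \<Rightarrow> val"
  and subst_computation :: "nat \<Rightarrow> val \<Rightarrow> computation \<Rightarrow> computation" where
  "subst_val k U (Var i) = (if i < k then Var i else if i = k then U else Var (i - 1))"
| "subst_val k U (Lam M) = Lam (subst_computation (Suc k) (lift_val 0 U) M)"
| "subst_computation k U (Ret V) = Ret (subst_val k U V)"
| "subst_computation k U (App V M) = App (subst_val k U V) (subst_computation k U M)"

inductive beta_c :: "computation \<Rightarrow> computation \<Rightarrow> bool" where
  "beta_c (App (Lam M) (Ret V)) (subst_computation 0 V M)"

inductive id_rule :: "computation \<Rightarrow> computation \<Rightarrow> bool" where
  "id_rule (App (Lam (Ret (Var 0))) M) M"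

text \<open>In \<open>\<sigma>\<close> the abstraction \<open>\<lambda>y.N\<close> moves under the binder \<open>x\<close>. The lifting expresses the
  proviso that \<open>x\<close> is not free in \<open>N\<close>, which can always be met by renaming \<open>x\<close>.\<close>

inductive sigma :: "computation \<Rightarrow> computation \<Rightarrow> bool" where
  "sigma (App (Lam N) (App (Lam M) L)) (App (Lam (App (lift_val 0 (Lam N)) M)) L)"

definition sigma_beta_c :: "computation \<Rightarrow> computation \<Rightarrow> bool" where
  "sigma_beta_c = sup sigma beta_c"

definition circledc :: "computation \<Rightarrow> computation \<Rightarrow> bool" where
  "circledc = sup beta_c (sup id_rule sigma)"

datatype ctx =
    Hole
  | RetLam ctx               (* \<open>!(\<lambda>x.C)\<close> *)
  | AppArg val ctx           (* \<open>V C\<close> *)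
  | AppLam ctx computation   (* \<open>(\<lambda>x.C) M\<close> *)

text \<open>Filling the hole may capture variables, hence no lifting of \<open>P\<close>.\<close>

primrec plug :: "ctx \<Rightarrow> computation \<Rightarrow> computation" where
  "plug Hole P = P"
| "plug (RetLam C) P = Ret (Lam (plug C P))"
| "plug (AppArg V C) P = App V (plug C P)"
| "plug (AppLam C M) P = App (Lam (plug C P)) M"

inductive step :: "(computation \<Rightarrow> computation \<Rightarrow> bool) \<Rightarrow> computation \<Rightarrow> computation \<Rightarrow> bool"
  for \<rho> where
  "\<rho> M N \<Longrightarrow> step \<rho> (plug C M) (plug C N)"

definition normal_form :: "('a \<Rightarrow> 'a \<Rightarrow> bool) \<Rightarrow> 'a \<Rightarrow> bool" where
  "normal_form r M \<longleftrightarrow> (\<nexists>N. r M N)"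

definition normalizing :: "('a \<Rightarrow> 'a \<Rightarrow> bool) \<Rightarrow> 'a \<Rightarrow> bool" where
  "normalizing r M \<longleftrightarrow> (\<exists>N. r\<^sup>*\<^sup>* M N \<and> normal_form r N)"

end

theory Submission imports Defs begin

text \<open>Let \<open>\<Rightarrow>\<close> be parallel \<open>id\<close>-reduction. If \<open>L \<Rightarrow> L'\<close> then every \<open>\<sigma>\<beta>\<^sub>c\<close>-step of
  \<open>L'\<close> is simulated from \<open>L\<close>: an identity \<open>I = \<lambda>x.!x\<close> that hides a redex of \<open>L'\<close> either meets a
  returned value and disappears by \<open>\<beta>\<^sub>c\<close>, or meets \<open>(\<lambda>x.M) N\<close> and \<open>\<sigma>\<close> pushes it inside the body \<open>M\<close>.
  Likewise, if \<open>L'\<close> is \<open>\<sigma>\<beta>\<^sub>c\<close>-normal then \<open>L\<close> is \<open>\<sigma>\<beta>\<^sub>c\<close>-normalizing; here one also needs that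
  \<open>(\<lambda>y.N)(I M)\<close> reduces to \<open>(\<lambda>y.N) M\<close> by \<open>\<sigma>\<close> and then \<open>\<beta>\<^sub>c\<close>. So \<open>\<sigma>\<beta>\<^sub>c\<close>-normalization is
  stable under \<open>id\<close>-expansion. Conversely, \<open>id\<close>-steps shrink terms and
  preserve \<open>\<sigma>\<beta>\<^sub>c\<close>-normality.\<close>

abbreviation sb :: "computation \<Rightarrow> computation \<Rightarrow> bool" where
  "sb \<equiv> step sigma_beta_c"

abbreviation app_id :: "computation \<Rightarrow> computation" where
  "app_id \<equiv> App (Lam (Ret (Var 0)))"

section \<open>Contextual closure as a congruence\<close>

lemma step_root: "\<rho> M N \<Longrightarrow> step \<rho> M N"
  using step.intros[of \<rho> M N Hole] by simp

lemma step_RetLam: "step \<rho> P P' \<Longrightarrow> step \<rho> (Ret (Lam P)) (Ret (Lam P'))"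
  by (metis plug.simps(2) step.simps)

lemma step_AppArg: "step \<rho> M M' \<Longrightarrow> step \<rho> (App V M) (App V M')"
  by (metis plug.simps(3) step.simps)

lemma step_AppLam: "step \<rho> P P' \<Longrightarrow> step \<rho> (App (Lam P) M) (App (Lam P') M)"
  by (metis plug.simps(4) step.simps)

lemma step_Ret_iff:
  "step \<rho> (Ret V) N \<longleftrightarrow>
    \<rho> (Ret V) N \<or> (\<exists>P P'. V = Lam P \<and> N = Ret (Lam P') \<and> step \<rho> P P')"
  (is "?L \<longleftrightarrow> ?R")
proof
  assume ?L
  then obtain C A B where "Ret V = plug C A" "N = plug C B" "\<rho> A B"
    by cases metis
  then show ?R by (cases C) (auto simp: step.intros)
next
  assume ?R
  then show ?L by (metis step_root step_RetLam)
qed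

text \<open>Inversion by the outermost layer of the context, so that later proofs need no
  contexts.\<close>

lemma step_App_iff:
  "step \<rho> (App V M) N \<longleftrightarrow>
    \<rho> (App V M) N \<or> (\<exists>M'. N = App V M' \<and> step \<rho> M M') \<or>
    (\<exists>P P'. V = Lam P \<and> N = App (Lam P') M \<and> step \<rho> P P')"
  (is "?L \<longleftrightarrow> ?R")
proof
  assume ?L
  then obtain C A B where "App V M = plug C A" "N = plug C B" "\<rho> A B"
    by cases metis
  then show ?R by (cases C) (auto simp: step.intros)
next
  assume ?R
  then show ?L by (metis step_root step_AppArg step_AppLam)
qed

lemma rtranclp_step_Ret:
  "(step \<rho>)\<^sup>*\<^sup>* P P' \<Longrightarrow> (step \<rho>)\<^sup>*\<^sup>* (Ret (Lam P)) (Ret (Lam P'))"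
  by (induction rule: rtranclp_induct) (auto intro: rtranclp.rtrancl_into_rtrancl step_RetLam)

lemma rtranclp_step_AppArg:
  "(step \<rho>)\<^sup>*\<^sup>* M M' \<Longrightarrow> (step \<rho>)\<^sup>*\<^sup>* (App V M) (App V M')"
  by (induction rule: rtranclp_induct) (auto intro: rtranclp.rtrancl_into_rtrancl step_AppArg)

lemma rtranclp_step_AppLam:
  "(step \<rho>)\<^sup>*\<^sup>* P P' \<Longrightarrow> (step \<rho>)\<^sup>*\<^sup>* (App (Lam P) M) (App (Lam P') M)"
  by (induction rule: rtranclp_induct) (auto intro: rtranclp.rtrancl_into_rtrancl step_AppLam)

lemma rtranclp_step_App:
  assumes "(step \<rho>)\<^sup>*\<^sup>* P P'" "(step \<rho>)\<^sup>*\<^sup>* M M'"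
  shows "(step \<rho>)\<^sup>*\<^sup>* (App (Lam P) M) (App (Lam P') M')"
  using rtranclp_step_AppLam[OF assms(1)] rtranclp_step_AppArg[OF assms(2)] by (rule rtranclp_trans)

lemma step_sup: "step (sup \<rho> \<tau>) M N \<longleftrightarrow> step \<rho> M N \<or> step \<tau> M N"
  by (auto simp: step.simps)

lemma step_circledc: "step circledc M N \<longleftrightarrow> sb M N \<or> step id_rule M N"
  by (auto simp: circledc_def sigma_beta_c_def step_sup)

section \<open>Basic steps of \<open>sb\<close>\<close>

lemma sb_beta: "sb (App (Lam P) (Ret V)) (subst_computation 0 V P)"
  by (auto simp: step_App_iff sigma_beta_c_def intro: beta_c.intros)

lemma sb_sigma:
  "sb (App (Lam N) (App (Lam M) L)) (App (Lam (App (lift_val 0 (Lam N)) M)) L)"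
  using sigma.intros by (auto simp: step_App_iff sigma_beta_c_def)

text \<open>The lift opens a gap just above \<open>k\<close>; the substitution puts
  \<open>Var k\<close> in place of \<open>k\<close> and closes the gap.\<close>

lemma subst_Var_lift:
  "subst_val k (Var k) (lift_val (Suc k) V) = V"
  "subst_computation k (Var k) (lift_computation (Suc k) M) = M"
  by (induction V and M arbitrary: k and k) auto

lemma rtranclp_sb_drop_id: "sb\<^sup>*\<^sup>* (App (Lam N) (app_id M)) (App (Lam N) M)"
proof -
  have "sb (App (Lam N) (app_id M)) (App (Lam (App (lift_val 0 (Lam N)) (Ret (Var 0)))) M)"
    by (rule sb_sigma)
  \<comment> \<open>Under the binder of the former identity the abstraction meets the bound
    variable, so \<open>beta_c\<close> merely renames.\<close>
  moreover have "sb (App (lift_val 0 (Lam N)) (Ret (Var 0))) N"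
    using sb_beta[of "lift_computation (Suc 0) N" "Var 0"] by (simp add: subst_Var_lift)
  then have "sb (App (Lam (App (lift_val 0 (Lam N)) (Ret (Var 0)))) M) (App (Lam N) M)"
    by (auto simp: step_App_iff[of _ "Lam _" M])
  ultimately show ?thesis by auto
qed

section \<open>Parallel \<open>id\<close>-reduction\<close>

text \<open>Parallel, because \<open>beta_c\<close> may copy a value that contains
  \<open>id\<close>-redexes, and all copies must be contracted together. Rule \<open>Id\<close> lets
  a whole stack of identities vanish at once.\<close>

inductive par_id_val :: "val \<Rightarrow> val \<Rightarrow> bool"
  and par_id :: "computation \<Rightarrow> computation \<Rightarrow> bool" where
  Var: "par_id_val (Var i) (Var i)"
| Lam: "par_id P P' \<Longrightarrow> par_id_val (Lam P) (Lam P')"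
| Ret: "par_id_val V V' \<Longrightarrow> par_id (Ret V) (Ret V')"
| App: "par_id_val V V' \<Longrightarrow> par_id M M' \<Longrightarrow> par_id (App V M) (App V' M')"
| Id: "par_id M M' \<Longrightarrow> par_id (app_id M) M'"

inductive_cases par_id_val_LamE: "par_id_val V (Lam P')"
inductive_cases par_id_val_VarE: "par_id_val V (Var i)"

lemma par_id_refl: "par_id_val V V" "par_id M M"
  by (induction V and M) (auto intro: par_id_val_par_id.intros)

lemma step_id_imp_par_id: "step id_rule M N \<Longrightarrow> par_id M N"
proof (induction rule: step.induct)
  case (1 M N C)
  then show ?case
    by (induction C) (auto elim!: id_rule.cases intro: par_id_val_par_id.intros par_id_refl)
qed

lemma par_id_lift:
  "par_id_val V V' \<Longrightarrow> par_id_val (lift_val k V) (lift_val k V')"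
  "par_id M M' \<Longrightarrow> par_id (lift_computation k M) (lift_computation k M')"
  by (induction arbitrary: k and k rule: par_id_val_par_id.inducts)
    (auto intro: par_id_val_par_id.intros)

text \<open>The identity is closed, so an \<open>id\<close>-redex stays one under
  substitution.\<close>

lemma par_id_subst:
  "par_id_val V V' \<Longrightarrow> par_id_val U U' \<Longrightarrow> par_id_val (subst_val k U V) (subst_val k U' V')"
  "par_id M M' \<Longrightarrow> par_id_val U U' \<Longrightarrow>
    par_id (subst_computation k U M) (subst_computation k U' M')"
proof (induction arbitrary: k U U' and k U U' rule: par_id_val_par_id.inducts)
  case (Lam P P')
  from par_id_lift(1)[OF Lam.prems] have "par_id_val (lift_val 0 U) (lift_val 0 U')" .
  then show ?case using Lam.IH by (simp add: par_id_val_par_id.Lam)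
qed (simp_all add: par_id_val_par_id.intros)

section \<open>Exposing the shape of the reduct by \<open>sb\<close>-steps\<close>

text \<open>\<open>M\<close> is a stack of identities on a returned value; \<open>beta_c\<close>
  removes them from the innermost outwards.\<close>

lemma par_id_to_Ret:
  "par_id M (Ret V') \<Longrightarrow> \<exists>V. sb\<^sup>*\<^sup>* M (Ret V) \<and> par_id_val V V'"
proof (induction M "Ret V'" rule: par_id_val_par_id.inducts(2)[where ?P1.0 = "\<lambda>_ _. True"])
  case (Id M)
  then obtain V where V: "sb\<^sup>*\<^sup>* M (Ret V)" "par_id_val V V'" by auto
  have "sb\<^sup>*\<^sup>* (app_id M) (app_id (Ret V))"
    using V(1) by (rule rtranclp_step_AppArg)
  also have "sb (app_id (Ret V)) (Ret V)"
    using sb_beta[of "Ret (Var 0)" V] by simp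
  finally show ?case using V(2) by blast
qed auto

text \<open>\<open>sigma\<close> moves each identity of the stack into the body of the abstraction,
  where rule \<open>Id\<close> still erases it.\<close>

lemma par_id_to_App_Lam:
  "par_id M (App (Lam P') L') \<Longrightarrow>
    \<exists>P L. sb\<^sup>*\<^sup>* M (App (Lam P) L) \<and> par_id P P' \<and> par_id L L'"
proof (induction M "App (Lam P') L'" rule: par_id_val_par_id.inducts(2)[where ?P1.0 = "\<lambda>_ _. True"])
  case (App V M)
  from App.hyps(1) obtain P where "V = Lam P" "par_id P P'" by (rule par_id_val_LamE)
  with App.hyps(3) show ?case by blast
next
  case (Id M)
  then obtain P L where PL: "sb\<^sup>*\<^sup>* M (App (Lam P) L)" "par_id P P'" "par_id L L'" by auto
  have "sb\<^sup>*\<^sup>* (app_id M) (app_id (App (Lam P) L))"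
    using PL(1) by (rule rtranclp_step_AppArg)
  also have "sb (app_id (App (Lam P) L)) (App (Lam (app_id P)) L)"
    using sb_sigma[of "Ret (Var 0)" P L] by simp
  finally show ?case using PL(2,3) par_id_val_par_id.Id by blast
qed auto

lemma par_id_to_App_Var:
  "par_id M (App (Var x) R') \<Longrightarrow>
    \<exists>R. par_id R R' \<and> (sb\<^sup>*\<^sup>* M (App (Var x) R) \<or> sb\<^sup>*\<^sup>* M (app_id (App (Var x) R)))"
proof (induction M "App (Var x) R'" rule: par_id_val_par_id.inducts(2)[where ?P1.0 = "\<lambda>_ _. True"])
  case (App V M)
  from App.hyps(1) have "V = Var x" by (rule par_id_val_VarE)
  with App.hyps(3) show ?case by blast
next
  case (Id M)
  then obtain R where R: "par_id R R'"
    "sb\<^sup>*\<^sup>* M (App (Var x) R) \<or> sb\<^sup>*\<^sup>* M (app_id (App (Var x) R))" by auto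
  from R(2) have "sb\<^sup>*\<^sup>* (app_id M) (app_id (App (Var x) R))"
    by (metis rtranclp_step_AppArg rtranclp_sb_drop_id rtranclp_trans)
  then show ?case using R(1) by blast
qed auto

section \<open>Simulation of \<open>sb\<close> across \<open>par_id\<close>\<close>

text \<open>The argument is first brought to the shape that the redex requires; then the same rule
  fires.\<close>

lemma par_id_sb_root:
  assumes "par_id_val V V'" "par_id M M'" "sigma_beta_c (App V' M') N'"
  shows "\<exists>N. sb\<^sup>*\<^sup>* (App V M) N \<and> par_id N N'"
proof -
  consider (sigma) "sigma (App V' M') N'" | (beta) "beta_c (App V' M') N'"
    using assms(3) by (auto simp: sigma_beta_c_def)
  then show ?thesis
  proof cases
    case sigma
    then obtain Q' P' L' where eq: "V' = Lam Q'" "M' = App (Lam P') L'"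
      "N' = App (Lam (App (lift_val 0 (Lam Q')) P')) L'"
      by (auto elim: sigma.cases)
    from assms(1) eq obtain Q where Q: "V = Lam Q" by (auto elim: par_id_val_LamE)
    from assms(2) eq obtain P L where PL: "sb\<^sup>*\<^sup>* M (App (Lam P) L)" "par_id P P'" "par_id L L'"
      using par_id_to_App_Lam by blast
    have "sb\<^sup>*\<^sup>* (App V M) (App V (App (Lam P) L))"
      using PL(1) by (rule rtranclp_step_AppArg)
    also have "sb \<dots> (App (Lam (App (lift_val 0 V) P)) L)"
      unfolding Q by (rule sb_sigma)
    finally have "sb\<^sup>*\<^sup>* (App V M) (App (Lam (App (lift_val 0 V) P)) L)" .
    moreover have "par_id (App (Lam (App (lift_val 0 V) P)) L) N'"
      using par_id_lift(1)[OF assms(1), of 0] PL(2,3) unfolding eq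
      by (intro par_id_val_par_id.intros)
    ultimately show ?thesis by blast
  next
    case beta
    then obtain P' W' where eq: "V' = Lam P'" "M' = Ret W'" "N' = subst_computation 0 W' P'"
      by (auto elim: beta_c.cases)
    from assms(1) eq obtain P where P: "V = Lam P" "par_id P P'" by (auto elim: par_id_val_LamE)
    from assms(2) eq obtain W where W: "sb\<^sup>*\<^sup>* M (Ret W)" "par_id_val W W'"
      using par_id_to_Ret by blast
    have "sb\<^sup>*\<^sup>* (App V M) (App V (Ret W))"
      using W(1) by (rule rtranclp_step_AppArg)
    also have "sb \<dots> (subst_computation 0 W P)"
      unfolding P by (rule sb_beta)
    finally show ?thesis using par_id_subst(2)[OF P(2) W(2)] eq by blast
  qed
qed

lemma not_sigma_beta_c_Ret: "\<not> sigma_beta_c (Ret V) N"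
  by (auto simp: sigma_beta_c_def elim: sigma.cases beta_c.cases)

text \<open>Values take no steps, so their half of the mutual induction speaks of the bodies of
  abstractions. An identity erased by \<open>Id\<close> stays in front while its argument is
  simulated.\<close>

lemma par_id_sb_simulation:
  shows "par_id_val V V' \<Longrightarrow> \<forall>P' P''. V' = Lam P' \<longrightarrow> sb P' P'' \<longrightarrow>
      (\<exists>P P1. V = Lam P \<and> sb\<^sup>*\<^sup>* P P1 \<and> par_id P1 P'')"
    and "par_id L L' \<Longrightarrow> \<forall>L''. sb L' L'' \<longrightarrow> (\<exists>L1. sb\<^sup>*\<^sup>* L L1 \<and> par_id L1 L'')"
proof (induction rule: par_id_val_par_id.inducts)
  case (Ret V V')
  show ?case
  proof (intro allI impI)
    fix L''
    assume "sb (Ret V') L''"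
    then obtain P' P'' where "V' = Lam P'" "L'' = Ret (Lam P'')" "sb P' P''"
      by (auto simp: step_Ret_iff not_sigma_beta_c_Ret)
    with Ret obtain P P1 where "V = Lam P" "sb\<^sup>*\<^sup>* P P1" "par_id P1 P''" "L'' = Ret (Lam P'')"
      by blast
    then show "\<exists>L1. sb\<^sup>*\<^sup>* (Ret V) L1 \<and> par_id L1 L''"
      by (blast intro: rtranclp_step_Ret par_id_val_par_id.Ret par_id_val_par_id.Lam)
  qed
next
  case (App V V' M M')
  show ?case
  proof (intro allI impI)
    fix L''
    assume "sb (App V' M') L''"
    then consider "sigma_beta_c (App V' M') L''"
      | M'' where "L'' = App V' M''" "sb M' M''"
      | P' P'' where "V' = Lam P'" "L'' = App (Lam P'') M'" "sb P' P''"
      by (auto simp: step_App_iff)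
    then show "\<exists>L1. sb\<^sup>*\<^sup>* (App V M) L1 \<and> par_id L1 L''"
    proof cases
      case 1
      show ?thesis by (rule par_id_sb_root[OF App.hyps 1])
    next
      case 2
      with App.IH(2) obtain M1 where "sb\<^sup>*\<^sup>* M M1" "par_id M1 M''" by blast
      then show ?thesis
        using 2(1) rtranclp_step_AppArg par_id_val_par_id.App[OF App.hyps(1)] by blast
    next
      case 3
      with App.IH(1) obtain P P1 where "V = Lam P" "sb\<^sup>*\<^sup>* P P1" "par_id P1 P''" by blast
      moreover from this(3) have "par_id (App (Lam P1) M) L''"
        unfolding 3(2) by (intro par_id_val_par_id.App par_id_val_par_id.Lam App.hyps)
      ultimately show ?thesis using rtranclp_step_AppLam by blast
    qed
  qed
next
  case (Id M M')
  then show ?case using rtranclp_step_AppArg par_id_val_par_id.Id by blast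
qed auto

lemma par_id_rtranclp_sb_simulation:
  assumes "sb\<^sup>*\<^sup>* L' L''" "par_id L L'"
  shows "\<exists>L1. sb\<^sup>*\<^sup>* L L1 \<and> par_id L1 L''"
  using assms
proof (induction rule: rtranclp_induct)
  case (step N N')
  then show ?case using par_id_sb_simulation(2) by (meson rtranclp_trans)
qed auto

section \<open>Normal forms and \<open>id\<close>-expansion\<close>

lemma nf_sb_Ret: "normal_form sb (Ret V) \<longleftrightarrow> (\<forall>P. V = Lam P \<longrightarrow> normal_form sb P)"
  by (auto simp: normal_form_def step_Ret_iff not_sigma_beta_c_Ret)

text \<open>Under an abstraction, a returned value as argument triggers \<open>beta_c\<close>, an
  applied abstraction triggers \<open>sigma\<close>, and an applied variable blocks both.\<close>

lemma sigma_beta_c_App_iff: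
  "(\<exists>N. sigma_beta_c (App V M) N) \<longleftrightarrow> (\<exists>P. V = Lam P) \<and> (\<forall>x R. M \<noteq> App (Var x) R)"
proof
  assume "\<exists>N. sigma_beta_c (App V M) N"
  then show "(\<exists>P. V = Lam P) \<and> (\<forall>x R. M \<noteq> App (Var x) R)"
    by (auto simp: sigma_beta_c_def elim: sigma.cases beta_c.cases)
next
  assume "(\<exists>P. V = Lam P) \<and> (\<forall>x R. M \<noteq> App (Var x) R)"
  then consider P W where "V = Lam P" "M = Ret W" | P Q L where "V = Lam P" "M = App (Lam Q) L"
    by (metis computation.exhaust val.exhaust)
  then show "\<exists>N. sigma_beta_c (App V M) N"
  proof cases
    case 1
    then show ?thesis using beta_c.intros[of P W] by (auto simp: sigma_beta_c_def)
  next
    case 2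
    then have "sigma_beta_c (App V M) (App (Lam (App (lift_val 0 (Lam P)) Q)) L)"
      unfolding sigma_beta_c_def by (simp add: sigma.intros del: lift_val.simps)
    then show ?thesis ..
  qed
qed

lemma nf_sb_App:
  "normal_form sb (App V M) \<longleftrightarrow> normal_form sb M \<and>
    (\<forall>P. V = Lam P \<longrightarrow> normal_form sb P \<and> (\<exists>x R. M = App (Var x) R))"
proof -
  have "normal_form sb (App V M) \<longleftrightarrow> (\<nexists>N. sigma_beta_c (App V M) N) \<and> normal_form sb M \<and>
      (\<forall>P. V = Lam P \<longrightarrow> normal_form sb P)"
    by (auto simp: normal_form_def step_App_iff)
  then show ?thesis unfolding sigma_beta_c_App_iff by auto
qed

text \<open>An argument of an abstraction must lose its leading identity, since otherwise \<open>\<sigma>\<close> applies;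
  the last conjunct makes the induction hypothesis strong enough for this.\<close>

lemma par_id_nf_sb:
  "par_id L N \<Longrightarrow> normal_form sb N \<Longrightarrow>
    \<exists>N1. sb\<^sup>*\<^sup>* L N1 \<and> normal_form sb N1 \<and>
      (\<forall>x R. N = App (Var x) R \<longrightarrow> (\<exists>S. N1 = App (Var x) S \<or> N1 = app_id (App (Var x) S)))"
\<comment> \<open>The size of \<open>N\<close> decreases, whereas exposing the shape of
  \<open>L\<close> may yield parts that are not subterms of \<open>L\<close>.\<close>
proof (induction N arbitrary: L rule: measure_induct_rule[of size])
  case (less N)
  consider (Ret_Var) x where "N = Ret (Var x)" | (Ret_Lam) P where "N = Ret (Lam P)"
    | (App_Var) x R where "N = App (Var x) R" | (App_Lam) P R where "N = App (Lam P) R"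
    by (metis computation.exhaust val.exhaust)
  then show ?case
  proof cases
    case Ret_Var
    with less.prems show ?thesis using par_id_to_Ret[of L "Var x"] by (auto elim: par_id_val_VarE)
  next
    case (Ret_Lam P')
    with less.prems obtain P where P: "sb\<^sup>*\<^sup>* L (Ret (Lam P))" "par_id P P'"
      using par_id_to_Ret[of L "Lam P'"] by (auto elim: par_id_val_LamE)
    moreover from Ret_Lam less.prems(2) have "size P' < size N" "normal_form sb P'"
      by (auto simp: nf_sb_Ret)
    ultimately obtain P1 where "sb\<^sup>*\<^sup>* P P1" "normal_form sb P1"
      using less.IH[of P' P] by metis
    then show ?thesis
      using Ret_Lam P(1) rtranclp_step_Ret[of sigma_beta_c P P1]
      by (auto simp: nf_sb_Ret intro: rtranclp_trans)
  next
    case (App_Var x R')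
    with less.prems obtain R where R: "par_id R R'"
      "sb\<^sup>*\<^sup>* L (App (Var x) R) \<or> sb\<^sup>*\<^sup>* L (app_id (App (Var x) R))"
      using par_id_to_App_Var by blast
    from App_Var less.prems(2) have "size R' < size N" "normal_form sb R'"
      by (auto simp: nf_sb_App)
    with R(1) obtain R1 where R1: "sb\<^sup>*\<^sup>* R R1" "normal_form sb R1"
      using less.IH[of R' R] by metis
    \<comment> \<open>A single identity in front of an applied variable is itself normal, so it may
      stay.\<close>
    have nf: "normal_form sb (App (Var x) R1)" "normal_form sb (app_id (App (Var x) R1))"
      using R1(2) by (auto simp: nf_sb_App nf_sb_Ret)
    have "sb\<^sup>*\<^sup>* L (App (Var x) R1) \<or> sb\<^sup>*\<^sup>* L (app_id (App (Var x) R1))"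
      using R(2) R1(1) by (meson rtranclp_step_AppArg rtranclp_trans)
    then show ?thesis using nf App_Var by blast
  next
    case (App_Lam P' R')
    with less.prems obtain P R where PR: "sb\<^sup>*\<^sup>* L (App (Lam P) R)" "par_id P P'" "par_id R R'"
      using par_id_to_App_Lam by blast
    from App_Lam less.prems obtain x S' where R': "R' = App (Var x) S'"
      and nf: "normal_form sb P'" "normal_form sb R'"
      by (auto simp: nf_sb_App)
    have "size P' < size N" "size R' < size N" using App_Lam by auto
    from less.IH[OF this(1) PR(2) nf(1)] obtain P1 where P1: "sb\<^sup>*\<^sup>* P P1" "normal_form sb P1"
      by metis
    from less.IH[OF \<open>size R' < size N\<close> PR(3) nf(2)] R' obtain R1 S where
      R1: "sb\<^sup>*\<^sup>* R R1" "normal_form sb R1" "R1 = App (Var x) S \<or> R1 = app_id (App (Var x) S)"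
      by metis
    have "sb\<^sup>*\<^sup>* L (App (Lam P1) R1)"
      using PR(1) rtranclp_step_App[OF P1(1) R1(1)] by (rule rtranclp_trans)
    also have "sb\<^sup>*\<^sup>* (App (Lam P1) R1) (App (Lam P1) (App (Var x) S))"
      using R1(3) rtranclp_sb_drop_id by auto
    finally have "sb\<^sup>*\<^sup>* L (App (Lam P1) (App (Var x) S))" .
    moreover have "normal_form sb (App (Lam P1) (App (Var x) S))"
      using P1(2) R1(2,3) by (auto simp: nf_sb_App)
    ultimately show ?thesis using App_Lam by blast
  qed
qed

section \<open>Transfer of normalization\<close>

lemma normalizing_sb_par_id_expansion:
  assumes "par_id L L'" "normalizing sb L'"
  shows "normalizing sb L"
proof -
  from assms(2) obtain N where N: "sb\<^sup>*\<^sup>* L' N" "normal_form sb N"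
    by (auto simp: normalizing_def)
  from par_id_rtranclp_sb_simulation[OF N(1) assms(1)] obtain L1
    where L1: "sb\<^sup>*\<^sup>* L L1" "par_id L1 N" by blast
  from par_id_nf_sb[OF L1(2) N(2)] L1(1) show ?thesis
    unfolding normalizing_def by (meson rtranclp_trans)
qed

text \<open>In a normal form every argument of an abstraction is some \<open>App (Var x) S\<close>.
  An \<open>id\<close>-step cannot act at its root, so the shape persists and no redex is
  created.\<close>

lemma nf_sb_step_id:
  "normal_form sb M \<Longrightarrow> step id_rule M N \<Longrightarrow> normal_form sb N \<and> size N < size M"
proof (induction M arbitrary: N rule: measure_induct_rule[of size])
  case (less M)
  show ?case
  proof (cases M)
    case (Ret V)
    with less.prems obtain P P' where "V = Lam P" "N = Ret (Lam P')" "step id_rule P P'"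
      by (auto simp: step_Ret_iff elim: id_rule.cases)
    with less.IH[of P P'] less.prems(1) Ret show ?thesis by (auto simp: nf_sb_Ret)
  next
    case (App V R)
    with less.prems(2) consider "id_rule (App V R) N"
      | R' where "N = App V R'" "step id_rule R R'"
      | P P' where "V = Lam P" "N = App (Lam P') R" "step id_rule P P'"
      by (auto simp: step_App_iff)
    then show ?thesis
    proof cases
      case 1
      with less.prems(1) App show ?thesis by (auto elim!: id_rule.cases simp: nf_sb_App)
    next
      case 2
      have "normal_form sb R' \<and> size R' < size R"
        using less.IH[of R R'] less.prems(1) 2 App by (auto simp: nf_sb_App)
      moreover have "\<exists>x S. R' = App (Var x) S" if "R = App (Var x) S" for x S
        using 2 that by (auto simp: step_App_iff elim: id_rule.cases)
      ultimately show ?thesis using less.prems(1) App 2 by (auto simp: nf_sb_App)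
    next
      case 3
      then show ?thesis using less.IH[of P P'] less.prems(1) App by (auto simp: nf_sb_App)
    qed
  qed
qed

text \<open>The decreasing size bounds the number of \<open>id\<close>-steps, and a term normal for
  both \<open>sb\<close> and \<open>id\<close> is normal for \<open>circledc\<close>.\<close>

lemma nf_sb_normalizing_circledc:
  "normal_form sb M \<Longrightarrow> normalizing (step circledc) M"
proof (induction M rule: measure_induct_rule[of size])
  case (less M)
  show ?case
  proof (cases "\<exists>N. step id_rule M N")
    case True
    then obtain N where N: "step id_rule M N" by blast
    with less have "normalizing (step circledc) N" using nf_sb_step_id by blast
    moreover have "step circledc M N" using N by (simp add: step_circledc)
    ultimately show ?thesis
      unfolding normalizing_def by (meson converse_rtranclp_into_rtranclp)
  next
    case False
    with less.prems have "normal_form (step circledc) M"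
      by (auto simp: normal_form_def step_circledc)
    then show ?thesis unfolding normalizing_def by blast
  qed
qed

theorem mainTheorem6:
  fixes M :: computation
  shows "normalizing (step circledc) M \<longleftrightarrow> normalizing (step sigma_beta_c) M"
proof
  assume "normalizing (step circledc) M"
  then obtain N where "(step circledc)\<^sup>*\<^sup>* M N" "normal_form (step circledc) N"
    by (auto simp: normalizing_def)
  then show "normalizing (step sigma_beta_c) M"
  \<comment> \<open>Normalization is carried back from \<open>N\<close>: along \<open>sb\<close> by
    prefixing the step, along \<open>id\<close> by expansion.\<close>
  proof (induction rule: converse_rtranclp_induct)
    case base
    then have "normal_form sb N" by (auto simp: normal_form_def step_circledc)
    then show ?case unfolding normalizing_def by blast
  next
    case (step M M')
    then have IH: "normalizing sb M'" by blast
    from step.hyps(1) consider "sb M M'" | "par_id M M'"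
      using step_id_imp_par_id by (auto simp: step_circledc)
    then show ?case
    proof cases
      case 1
      with IH show ?thesis
        unfolding normalizing_def by (meson converse_rtranclp_into_rtranclp)
    next
      case 2
      then show ?thesis using IH by (rule normalizing_sb_par_id_expansion)
    qed
  qed
next
  assume "normalizing (step sigma_beta_c) M"
  then obtain N where N: "sb\<^sup>*\<^sup>* M N" "normal_form sb N" by (auto simp: normalizing_def)
  \<comment> \<open>The \<open>sb\<close>-steps are kept as they are; after \<open>N\<close> only
    \<open>id\<close>-steps can follow.\<close>
  have "(step circledc)\<^sup>*\<^sup>* M N"
    using N(1) by (rule rtranclp_mono[THEN predicate2D, rotated]) (auto simp: step_circledc)
  with nf_sb_normalizing_circledc[OF N(2)] show "normalizing (step circledc) M"
    unfolding normalizing_def by (meson rtranclp_trans)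
qed

end
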